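(* Suppose that $b$ satisfies the inf-sup condition with constant $\mu>0$: $$\inf_{w\in U\setminus\{0\}}\ \sup_{v\in V\setminus\{0\}}\frac{|b(w,v)|}{\|w\|_U\|v\|_V}\ge\mu .$$ Let $u\in U$ be the solution of $b(u,v)=f(v)$ for all $v\in V$. Let $(u_h,r_n)\in U_h\times\mathcal{M}_n$ be a solution of the mixed minimal-residual problem with residual set $\mathcal{M}_n$, that is, $$r_n\in\arg\min_{v_n\in\mathcal{M}_n}\left(\tfrac12\|v_n\|_V^2-\langle f-Bu_h,v_n\rangle\right),\qquad b(w_h,r_n)=0\quad\forall w_h\in U_h .$$ Then $$\|u-u_h\|_U\le\frac1\mu\left(\|r_n\|_V+\inf_{v_\theta\in\mathcal{M}_n}\|\bar r-v_\theta\|_V\right),$$ where $\bar r:=R_V^{-1}(f-Bu_h)\in V$ is the exact residual representer.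
   Context: $U$ and $V$ are real Hilbert spaces with duals $U^*,V^*$; $U_h\subset U$ is a finite-dimensional linear subspace; $B:U\to V^*$ is a bounded linear operator, $b(u,v):=\langle Bu,v\rangle_{V^*,V}$, and $f\in V^*$. $R_V:V\to V^*$ is the Riesz map, $\langle R_Vr,v\rangle=(r,v)_V$. $\mathcal{M}_n\subset V$ is a nonempty set (not necessarily a linear space) of functions $v_\theta$ given by neural networks with parameters $\theta$. *)

theory Defs
  imports "HOL-Analysis.Analysis"
begin

definition bform :: "('u::real_normed_vector \<Rightarrow>\<^sub>L 'v::real_normed_vector \<Rightarrow>\<^sub>L real) \<Rightarrow> 'u \<Rightarrow> 'v \<Rightarrow> real"
  where "bform B w v = blinfun_apply (blinfun_apply B w) v"

text \<open>Infimum and supremum are taken in the extended reals, so that neither an unbounded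
  quotient nor an empty index set (a trivial space) yields an unspecified value.\<close>

definition inf_sup_condition ::
    "('u::real_normed_vector \<Rightarrow> 'v::real_normed_vector \<Rightarrow> real) \<Rightarrow> real \<Rightarrow> bool"
  where "inf_sup_condition b \<mu> \<longleftrightarrow>
    (INF w\<in>UNIV - {0}. SUP v\<in>UNIV - {0}. ereal (\<bar>b w v\<bar> / (norm w * norm v))) \<ge> ereal \<mu>"

text \<open>On a Hilbert space this map is a bijection onto the dual (Riesz representation theorem),
  so \<open>inv riesz_map\<close> is its genuine inverse.\<close>

abbreviation riesz_map :: "'v::real_inner \<Rightarrow> 'v \<Rightarrow>\<^sub>L real"
  where "riesz_map \<equiv> blinfun_inner_right"

definition residual_functional ::
    "('u::real_normed_vector \<Rightarrow>\<^sub>L 'v::real_normed_vector \<Rightarrow>\<^sub>L real) \<Rightarrow> ('v \<Rightarrow>\<^sub>L real) \<Rightarrow> 'u \<Rightarrow> 'v \<Rightarrow> real"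
  where "residual_functional B f w v =
    1 / 2 * (norm v)\<^sup>2 - blinfun_apply (f - blinfun_apply B w) v"

definition mixed_min_res_solution ::
    "('u::real_normed_vector \<Rightarrow>\<^sub>L 'v::real_normed_vector \<Rightarrow>\<^sub>L real) \<Rightarrow> ('v \<Rightarrow>\<^sub>L real)
      \<Rightarrow> 'u set \<Rightarrow> 'v set \<Rightarrow> 'u \<Rightarrow> 'v \<Rightarrow> bool"
  where "mixed_min_res_solution B f U\<^sub>h M u\<^sub>h r \<longleftrightarrow>
    u\<^sub>h \<in> U\<^sub>h \<and>
    is_arg_min (residual_functional B f u\<^sub>h) (\<lambda>v. v \<in> M) r \<and>
    (\<forall>w\<in>U\<^sub>h. bform B w r = 0)"

end

theory Submission
  imports Defs
begin

text \<open>The residual functional equals \<open>1/2 \<parallel>r_bar - v\<parallel>\<^sup>2 - 1/2 \<parallel>r_bar\<parallel>\<^sup>2\<close>, so \<open>r\<close> is a best approximation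
  of \<open>r_bar\<close> in \<open>M\<close> and the infimum is at least \<open>\<parallel>r_bar - r\<parallel>\<close>. Since \<open>r_bar\<close> represents
  \<open>b(u - u\<^sub>h, \<cdot>)\<close>, the inf-sup condition gives \<open>\<mu> \<parallel>u - u\<^sub>h\<parallel> \<le> \<parallel>r_bar\<parallel>\<close>, and the triangle inequality
  concludes. The Riesz representer itself is found by minimising \<open>1/2 \<parallel>v\<parallel>\<^sup>2 - f v\<close>.\<close>

text \<open>Parallelogram law: the contribution of \<open>f\<close> cancels by linearity at the
  midpoint. It turns closeness of energy values to the infimum into closeness of points.\<close>

lemma norm_diff_power2_eq_midpoint:
  fixes f :: "'a::real_inner \<Rightarrow>\<^sub>L real"
  defines "J \<equiv> \<lambda>v. 1 / 2 * (norm v)\<^sup>2 - blinfun_apply f v"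
  shows "1 / 4 * (norm (a - b))\<^sup>2 = J a + J b - 2 * J ((1 / 2) *\<^sub>R (a + b))"
  unfolding J_def
  by (simp add: power2_norm_eq_inner blinfun.add_right blinfun.scaleR_right inner_commute[of b a]
      inner_left_distrib inner_right_distrib inner_diff_left inner_diff_right algebra_simps)

text \<open>The operator norm bound reduces this to a square in \<open>norm f - norm v\<close>. It
  makes the infimum of the energy finite.\<close>

lemma energy_lower_bound:
  fixes f :: "'a::real_inner \<Rightarrow>\<^sub>L real"
  shows "- (norm f)\<^sup>2 / 2 \<le> 1 / 2 * (norm v)\<^sup>2 - blinfun_apply f v"
proof -
  have "blinfun_apply f v \<le> norm f * norm v"
    using norm_blinfun[of f v] by simp
  moreover have "0 \<le> (norm f - norm v)\<^sup>2"
    by simp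
  ultimately show ?thesis
    by (simp add: power2_diff)
qed

text \<open>Direct method: a minimising sequence is Cauchy by the midpoint identity, and continuity
  of \<open>J\<close> carries the infimum to its limit.\<close>

lemma energy_attains_min:
  fixes f :: "'a::{real_inner, complete_space} \<Rightarrow>\<^sub>L real"
  defines "J \<equiv> \<lambda>v. 1 / 2 * (norm v)\<^sup>2 - blinfun_apply f v"
  shows "\<exists>z. \<forall>v. J z \<le> J v"
proof -
  define c where "c = (INF v. J v)"
  have bdd: "bdd_below (range J)"
    using energy_lower_bound[of f] unfolding J_def bdd_below_def by blast
  have c_le: "c \<le> J v" for v
    unfolding c_def by (rule cINF_lower[OF bdd]) simp
  have "\<exists>v. J v < c + inverse (real (Suc n))" for n
    using cINF_less_iff[OF _ bdd, of "c + inverse (real (Suc n))"] unfolding c_def by auto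
  then obtain X where X: "\<And>n. J (X n) < c + inverse (real (Suc n))"
    by metis
  \<comment> \<open>Both energies exceed \<open>c\<close> by at most
    \<open>inverse (real (Suc N))\<close> and the midpoint has energy at least \<open>c\<close>, so
    a quarter of the squared distance is at most twice that excess; hence the 8.\<close>
  have dist_le: "(norm (X m - X n))\<^sup>2 \<le> 8 * inverse (real (Suc N))" if "m \<ge> N" "n \<ge> N" for m n N
  proof -
    have *: "J (X k) \<le> c + inverse (real (Suc N))" if "k \<ge> N" for k
    proof -
      have "inverse (real (Suc k)) \<le> inverse (real (Suc N))"
        using that by (intro le_imp_inverse_le) auto
      with X[of k] show ?thesis
        by linarith
    qed
    have "1 / 4 * (norm (X m - X n))\<^sup>2 =
        J (X m) + J (X n) - 2 * J ((1 / 2) *\<^sub>R (X m + X n))"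
      unfolding J_def by (rule norm_diff_power2_eq_midpoint)
    with *[OF that(1)] *[OF that(2)] c_le[of "(1 / 2) *\<^sub>R (X m + X n)"] show ?thesis
      by linarith
  qed
  have "Cauchy X"
  proof (rule CauchyI)
    fix e :: real
    assume "0 < e"
    then obtain N where N: "inverse (real (Suc N)) < e\<^sup>2 / 8"
      using reals_Archimedean[of "e\<^sup>2 / 8"] by auto
    have "norm (X m - X n) < e" if "m \<ge> N" "n \<ge> N" for m n
      using dist_le[OF that] N \<open>0 < e\<close> by (intro power2_less_imp_less[of _ e]) auto
    then show "\<exists>N. \<forall>m\<ge>N. \<forall>n\<ge>N. norm (X m - X n) < e"
      by blast
  qed
  then obtain z where z: "X \<longlonglongrightarrow> z"
    using Cauchy_convergent convergent_def by blast
  have "(\<lambda>n. J (X n)) \<longlonglongrightarrow> J z"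
    unfolding J_def by (intro tendsto_intros z)
  moreover have "(\<lambda>n. c + inverse (real (Suc n))) \<longlonglongrightarrow> c + 0"
    by (intro tendsto_intros LIMSEQ_inverse_real_of_nat)
  ultimately have "J z \<le> c + 0"
    by (rule LIMSEQ_le) (use X less_imp_le in blast)
  then show ?thesis
    using c_le by (metis add_0_right order_trans)
qed

text \<open>The first variation of the energy vanishes at a minimiser, and this Euler-Lagrange
  equation says that the minimiser represents \<open>f\<close>.\<close>

lemma riesz_representation:
  fixes f :: "'a::{real_inner, complete_space} \<Rightarrow>\<^sub>L real"
  shows "\<exists>z. riesz_map z = f"
proof -
  obtain z where z: "\<And>v. 1 / 2 * (norm z)\<^sup>2 - blinfun_apply f z \<le> 1 / 2 * (norm v)\<^sup>2 - blinfun_apply f v"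
    using energy_attains_min[of f] by blast
  have "inner z v = blinfun_apply f v" for v
  proof (cases "v = 0")
    case False
    define d where "d = inner z v - blinfun_apply f v"
    have expand: "0 \<le> t * d + t\<^sup>2 / 2 * (norm v)\<^sup>2" for t
    proof -
      have "(norm (z + t *\<^sub>R v))\<^sup>2 = (norm z)\<^sup>2 + 2 * t * inner z v + t\<^sup>2 * (norm v)\<^sup>2"
        by (simp add: power2_norm_eq_inner inner_commute[of v z] inner_left_distrib
            inner_right_distrib power2_eq_square[of t] algebra_simps)
      then show ?thesis
        using z[of "z + t *\<^sub>R v"] unfolding d_def
        by (simp add: blinfun.add_right blinfun.scaleR_right algebra_simps)
    qed
    \<comment> \<open>This \<open>t\<close> minimises the quadratic in \<open>expand\<close>; its
      value there is negative unless \<open>d = 0\<close>.\<close>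
    have "0 \<le> (- d / (norm v)\<^sup>2) * d + (- d / (norm v)\<^sup>2)\<^sup>2 / 2 * (norm v)\<^sup>2"
      by (rule expand)
    also have "\<dots> = - (d\<^sup>2 / (2 * (norm v)\<^sup>2))"
      using False by (simp add: field_simps power2_eq_square)
    finally have "d\<^sup>2 / (2 * (norm v)\<^sup>2) \<le> 0"
      by simp
    then have "d = 0"
      using False by (simp add: divide_le_0_iff)
    then show ?thesis
      by (simp add: d_def)
  qed simp
  then have "riesz_map z = f"
    by (intro blinfun_eqI) simp
  then show ?thesis ..
qed

text \<open>Surjectivity is what makes \<open>inv riesz_map\<close> a right inverse.\<close>

lemma riesz_map_inv:
  fixes f :: "'a::{real_inner, complete_space} \<Rightarrow>\<^sub>L real"
  shows "riesz_map (inv riesz_map f) = f"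
  using riesz_representation[of f] by (intro f_inv_into_f) auto

text \<open>Cauchy-Schwarz bounds every quotient at \<open>w\<close> by
  \<open>norm z / norm w\<close>, hence also their supremum; in a trivial test space that supremum
  is minus infinity and the bound still holds.\<close>

lemma inf_sup_condition_representer:
  fixes b :: "'u::real_normed_vector \<Rightarrow> 'v::real_inner \<Rightarrow> real"
  assumes "inf_sup_condition b \<mu>" and rep: "\<And>v. b w v = inner z v"
  shows "\<mu> * norm w \<le> norm z"
proof (cases "w = 0")
  case False
  have "ereal \<mu> \<le> (SUP v\<in>UNIV - {0}. ereal (\<bar>b w v\<bar> / (norm w * norm v)))"
    using assms(1) False unfolding inf_sup_condition_def by (auto simp: le_INF_iff)
  also have "\<dots> \<le> ereal (norm z / norm w)"
  proof (rule SUP_least)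
    fix v :: 'v
    assume "v \<in> UNIV - {0}"
    then show "ereal (\<bar>b w v\<bar> / (norm w * norm v)) \<le> ereal (norm z / norm w)"
      using False Cauchy_Schwarz_ineq2[of z v] by (simp add: rep field_simps)
  qed
  finally show ?thesis
    using False by (simp add: field_simps)
qed simp

text \<open>Completing the square: on any set, minimising the energy is the same as minimising the
  distance to \<open>z\<close>.\<close>

lemma energy_eq_dist_representer:
  fixes z :: "'a::real_inner"
  shows "1 / 2 * (norm v)\<^sup>2 - inner z v = 1 / 2 * (norm (z - v))\<^sup>2 - 1 / 2 * (norm z)\<^sup>2"
  by (simp add: power2_norm_eq_inner inner_diff_left inner_diff_right inner_commute[of v z]
      field_simps)

theorem theorem4:
  fixes B :: "'u::{real_inner, complete_space} \<Rightarrow>\<^sub>L 'v::{real_inner, complete_space} \<Rightarrow>\<^sub>L real"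
    and f :: "'v \<Rightarrow>\<^sub>L real"
    and \<mu> :: real
    and U\<^sub>h :: "'u set"
    and M :: "'v set"
    and u u\<^sub>h :: 'u
    and r :: 'v
  assumes "subspace U\<^sub>h" and "\<exists>S. finite S \<and> span S = U\<^sub>h"
    and "M \<noteq> {}"
    and "\<mu> > 0" and "inf_sup_condition (bform B) \<mu>"
    and "\<forall>v. bform B u v = blinfun_apply f v"
    and "mixed_min_res_solution B f U\<^sub>h M u\<^sub>h r"
  defines "r_bar \<equiv> inv riesz_map (f - blinfun_apply B u\<^sub>h)"
  shows "norm (u - u\<^sub>h) \<le> 1 / \<mu> * (norm r + (INF v\<in>M. norm (r_bar - v)))"
proof -
  have r_bar: "blinfun_apply (f - blinfun_apply B u\<^sub>h) v = inner r_bar v" for v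
    unfolding r_bar_def by (subst riesz_map_inv[symmetric]) simp
  have "bform B (u - u\<^sub>h) v = inner r_bar v" for v
    using assms(6) r_bar[of v] by (simp add: bform_def blinfun.diff_left blinfun.diff_right)
  then have "\<mu> * norm (u - u\<^sub>h) \<le> norm r_bar"
    by (rule inf_sup_condition_representer[OF assms(5)])
  also have "\<dots> \<le> norm r + norm (r_bar - r)"
    by (rule norm_triangle_sub)
  also have "norm (r_bar - r) \<le> (INF v\<in>M. norm (r_bar - v))"
  proof (rule cINF_greatest[OF assms(3)])
    fix v
    assume "v \<in> M"
    then have "residual_functional B f u\<^sub>h r \<le> residual_functional B f u\<^sub>h v"
      using assms(7) by (auto simp: mixed_min_res_solution_def is_arg_min_def not_less)
    \<comment> \<open>The constant \<open>1 / 2 * (norm r_bar)\<^sup>2\<close> cancels from both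
      sides.\<close>
    then have "(norm (r_bar - r))\<^sup>2 \<le> (norm (r_bar - v))\<^sup>2"
      unfolding residual_functional_def r_bar energy_eq_dist_representer by simp
    then show "norm (r_bar - r) \<le> norm (r_bar - v)"
      by (rule power2_le_imp_le) simp
  qed
  finally show ?thesis
    using assms(4) by (simp add: field_simps)
qed

end
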